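(* A probe graph $G^{N}$ has $\operatorname{mr}(G^{N})\le 2$ if and only if the complement $\overline{G}$ of $G$ has vertex set $V(H)$ and edge set $E(\overline{H})\cup S$, where $H$ is a graph whose complement is of the form $$(K_{s_1}\cup K_{s_2}\cup K_{p_1,q_1}\cup\cdots\cup K_{p_k,q_k})\vee K_r$$ for appropriate nonnegative integers $k,s_1,s_2,p_1,q_1,\dots,p_k,q_k,r$ with $p_i+q_i>0$ for all $i=1,\dots,k$, and $S$ is a subset of the edges of the complete graph on vertex set $N$.
   Context: Graphs are finite, simple and undirected. For a graph $G$, $\mathcal S(G)$ is the set of real symmetric matrices indexed by $V(G)$ whose off-diagonal $ij$ entry is nonzero if and only if $ij\in E(G)$; diagonal entries are arbitrary. A probe graph $G^{N}$ is a graph $G$ with an independent set $N\subseteq V(G)$ of non-probe vertices (so $N$ is a clique in $\overline G$). $\mathcal S(G^{N})$ is the union of $\mathcal S(H)$ over all graphs $H$ obtained from $G$ by adding any number of edges between vertices of $N$. $\operatorname{mr}(G^{N})$ is the minimum rank of a matrix in $\mathcal S(G^{N})$. $K_m$ is the complete graph on $m$ vertices, $K_{p,q}$ the complete bipartite graph with parts of sizes $p,q$ (if one of $p,q$ is $0$ it is edgeless), $\vee$ denotes the join, and $\cup$ between graphs the disjoint union. Graphs with $0$ vertices are allowed as constituents. *)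

theory Defs
  imports "HOL-Analysis.Analysis" "HOL-Library.Function_Algebras"
begin

section \<open>Finite simple graphs\<close>

datatype 'a sgraph = Graph (verts: "'a set") (edges: "'a set set")

definition all_edges :: "'a set \<Rightarrow> 'a set set" where
  "all_edges V = {{u, v} |u v. u \<in> V \<and> v \<in> V \<and> u \<noteq> v}"

text \<open>The empty vertex set is allowed.\<close>

definition simple_graph :: "'a sgraph \<Rightarrow> bool" where
  "simple_graph G \<longleftrightarrow> finite (verts G) \<and> edges G \<subseteq> all_edges (verts G)"

definition graph_compl :: "'a sgraph \<Rightarrow> 'a sgraph" where
  "graph_compl G = Graph (verts G) (all_edges (verts G) - edges G)"

definition graph_iso :: "'a sgraph \<Rightarrow> 'b sgraph \<Rightarrow> bool" where
  "graph_iso G H \<longleftrightarrow>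
     (\<exists>f. bij_betw f (verts G) (verts H) \<and> edges H = (\<lambda>e. f ` e) ` edges G)"

definition complete_on :: "'a set \<Rightarrow> 'a sgraph" where
  "complete_on V = Graph V (all_edges V)"

definition complete_graph :: "nat \<Rightarrow> nat sgraph" where
  "complete_graph m = complete_on {..<m}"

definition complete_bipartite :: "nat \<Rightarrow> nat \<Rightarrow> (nat + nat) sgraph" where
  "complete_bipartite p q =
     Graph ({..<p} <+> {..<q}) {{Inl i, Inr j} |i j. i < p \<and> j < q}"

definition disjoint_union :: "'a sgraph \<Rightarrow> 'b sgraph \<Rightarrow> ('a + 'b) sgraph" where
  "disjoint_union G H =
     Graph (verts G <+> verts H)
       ((\<lambda>e. Inl ` e) ` edges G \<union> (\<lambda>e. Inr ` e) ` edges H)"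

definition disjoint_Union :: "'i set \<Rightarrow> ('i \<Rightarrow> 'a sgraph) \<Rightarrow> ('i \<times> 'a) sgraph" where
  "disjoint_Union I G =
     Graph (SIGMA i:I. verts (G i)) (\<Union>i\<in>I. (\<lambda>e. Pair i ` e) ` edges (G i))"

definition graph_join :: "'a sgraph \<Rightarrow> 'b sgraph \<Rightarrow> ('a + 'b) sgraph" where
  "graph_join G H =
     Graph (verts G <+> verts H)
       (edges (disjoint_union G H) \<union> {{Inl u, Inr v} |u v. u \<in> verts G \<and> v \<in> verts H})"


section \<open>Matrices indexed by a finite set, and their rank\<close>

text \<open>
  A real matrix indexed by a finite set \<open>V\<close> is a function of two arguments that is \<open>0\<close>
  outside \<open>V \<times> V\<close>; padding a matrix with zeros does not affect its rank.
  As for the rank of matrices over index types in HOL-Analysis, the rank is the dimension of the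
  row space, here in the space of real functions with pointwise operations.
\<close>

definition matrices_on :: "'a set \<Rightarrow> ('a \<Rightarrow> 'a \<Rightarrow> real) set" where
  "matrices_on V = {A. \<forall>i j. i \<notin> V \<or> j \<notin> V \<longrightarrow> A i j = 0}"

interpretation fun_space: vector_space "\<lambda>(c::real) (f::'a \<Rightarrow> real). (\<lambda>x. c * f x)"
  by unfold_locales (auto simp: fun_eq_iff algebra_simps)

definition mat_rank :: "'a set \<Rightarrow> ('a \<Rightarrow> 'a \<Rightarrow> real) \<Rightarrow> nat" where
  "mat_rank V A = fun_space.dim (A ` V)"


section \<open>Probe graphs and minimum rank\<close>

definition sym_matrices :: "'a sgraph \<Rightarrow> ('a \<Rightarrow> 'a \<Rightarrow> real) set" where
  "sym_matrices G = {A \<in> matrices_on (verts G).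
     (\<forall>i\<in>verts G. \<forall>j\<in>verts G. A i j = A j i) \<and>
     (\<forall>i\<in>verts G. \<forall>j\<in>verts G. i \<noteq> j \<longrightarrow> (A i j \<noteq> 0 \<longleftrightarrow> {i, j} \<in> edges G))}"

definition probe_graph :: "'a sgraph \<Rightarrow> 'a set \<Rightarrow> bool" where
  "probe_graph G N \<longleftrightarrow>
     simple_graph G \<and> N \<subseteq> verts G \<and> (\<forall>u\<in>N. \<forall>v\<in>N. {u, v} \<notin> edges G)"

definition probe_matrices :: "'a sgraph \<Rightarrow> 'a set \<Rightarrow> ('a \<Rightarrow> 'a \<Rightarrow> real) set" where
  "probe_matrices G N =
     (\<Union>F\<in>Pow (all_edges N). sym_matrices (Graph (verts G) (edges G \<union> F)))"

text \<open>The set of attained ranks is never empty, so \<open>LEAST\<close> is a genuine minimum.\<close>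

definition probe_mr :: "'a sgraph \<Rightarrow> 'a set \<Rightarrow> nat" where
  "probe_mr G N = (LEAST r. \<exists>A\<in>probe_matrices G N. mat_rank (verts G) A = r)"

lemma probe_matrices_nonempty: "probe_matrices G N \<noteq> {}"
proof -
  have "(\<lambda>i j. if i \<in> verts G \<and> j \<in> verts G \<and> {i, j} \<in> edges G then 1 else 0)
          \<in> sym_matrices (Graph (verts G) (edges G \<union> {}))"
    by (auto simp: sym_matrices_def matrices_on_def insert_commute)
  then show ?thesis
    unfolding probe_matrices_def by blast
qed

end

theory Submission
  imports Defs
begin

text \<open>
  Adding the edges \<open>F\<close> inside \<open>N\<close> to \<open>G\<close> means deleting them from the complement, so the
  statement reduces to a single graph \<open>H\<close>: some matrix in \<open>sym_matrices H\<close> has rank at most \<open>2\<close>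
  iff the complement of \<open>H\<close> has the stated form (\<open>min_rank_two_iff_complement\<close>).

  Both sides are compared with a third description: the vertices of \<open>H\<close> are coloured so that the
  colours of two distinct vertices decide whether they are adjacent in the complement.
  For the stated form, the colour of a vertex is the constituent in which it lies, together with
  its side if the constituent is complete bipartite. Conversely a coloured graph is determined up to
  isomorphism by the sizes of its colour classes (\<open>bij_betw_fibres\<close>).

  Let \<open>A\<close> be symmetric of rank at most \<open>2\<close>, and call \<open>i\<close> and \<open>j\<close> orthogonal if \<open>A i j = 0\<close>.
  Think of \<open>A\<close> as the Gram matrix of vectors in a plane with a nondegenerate form: the zero vectors
  are the vertices of the complete graph joined to everything; a line orthogonal to itself gives
  a clique, and the plane contains at most two such lines (\<open>isotropic_rows_parallel\<close>); every other
  line has at most one orthogonal line, different from itself, and the two lines are the sides of a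
  complete bipartite graph (\<open>orthogonal_rows_parallel\<close>). The proof never constructs the plane: lines
  become classes of proportional rows, and the geometry follows from the linear
  dependence of any three rows (\<open>three_rows_dependent\<close>).

  In the other direction the plane is concrete: with the form \<open>x * y' + y * x'\<close> the two axes are
  the self-orthogonal lines, and the lines through \<open>(1, t)\<close> and \<open>(1, - t)\<close> with \<open>t > 0\<close> are the
  orthogonal pairs, so every colouring is realised by vectors (\<open>coloured_imp_rank_two\<close>).
\<close>

section \<open>Graphs defined by colours of the vertices\<close>

text \<open>
  The colours are the kinds of constituents: the complete graph that is joined to everything,
  the two cliques, and the bipartite graphs with index \<open>n\<close>, whose two sides carry opposite Booleans.
  The index type is left open, because indices first arise as sets of vertices and only
  later become numbers.
\<close>

datatype 'b colour = Dominating | Clique bool | Part 'b bool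

definition adj :: "'b colour \<Rightarrow> 'b colour \<Rightarrow> bool" where
  "adj x y \<longleftrightarrow> x = Dominating \<or> y = Dominating
     \<or> (\<exists>c. x = Clique c \<and> y = Clique c)
     \<or> (\<exists>n b. x = Part n b \<and> y = Part n (\<not> b))"

definition coloured_graph :: "'a set \<Rightarrow> ('a \<Rightarrow> 'b colour) \<Rightarrow> 'a sgraph" where
  "coloured_graph V f = Graph V {{u, v} |u v. u \<in> V \<and> v \<in> V \<and> u \<noteq> v \<and> adj (f u) (f v)}"

lemma adj_sym: "adj x y \<longleftrightarrow> adj y x"
  unfolding adj_def by auto

lemma verts_coloured_graph [simp]: "verts (coloured_graph V f) = V"
  by (simp add: coloured_graph_def)

lemma edge_coloured_graph_iff:
  "{u, v} \<in> edges (coloured_graph V f) \<longleftrightarrow> u \<in> V \<and> v \<in> V \<and> u \<noteq> v \<and> adj (f u) (f v)"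
  by (auto simp: coloured_graph_def doubleton_eq_iff adj_sym)

lemma edges_coloured_graph_subset: "edges (coloured_graph V f) \<subseteq> all_edges V"
  by (auto simp: coloured_graph_def all_edges_def)

lemma edge_sets_eqI:
  assumes "E \<subseteq> all_edges V" "F \<subseteq> all_edges V"
    and "\<And>u v. u \<in> V \<Longrightarrow> v \<in> V \<Longrightarrow> u \<noteq> v \<Longrightarrow> {u, v} \<in> E \<longleftrightarrow> {u, v} \<in> F"
  shows "E = F"
proof -
  have "e \<in> E \<longleftrightarrow> e \<in> F" for e
  proof (cases "e \<in> all_edges V")
    case True
    then obtain u v where "e = {u, v}" "u \<in> V" "v \<in> V" "u \<noteq> v"
      by (auto simp: all_edges_def)
    then show ?thesis using assms(3) by simp
  qed (use assms in auto)
  then show ?thesis by blast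
qed

lemma edge_in_all_edges: "{u, v} \<in> all_edges V \<longleftrightarrow> u \<in> V \<and> v \<in> V \<and> u \<noteq> v"
  by (auto simp: all_edges_def doubleton_eq_iff)

section \<open>Adjacency in the graph constructions\<close>

lemma pair_in_image_iff:
  assumes "inj h"
  shows "{h a, h b} \<in> (\<lambda>e. h ` e) ` E \<longleftrightarrow> {a, b} \<in> E"
proof -
  have "{h a, h b} = h ` {a, b}" by simp
  moreover have "inj (\<lambda>e. h ` e)" using assms by (simp add: inj_on_def inj_image_eq_iff)
  ultimately show ?thesis by (simp only: inj_image_mem_iff)
qed

lemma edge_disjoint_union:
  "{Inl a, Inl b} \<in> edges (disjoint_union G H) \<longleftrightarrow> {a, b} \<in> edges G"
  "{Inr c, Inr d} \<in> edges (disjoint_union G H) \<longleftrightarrow> {c, d} \<in> edges H"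
  "{Inl a, Inr d} \<notin> edges (disjoint_union G H)"
  "{Inr c, Inl b} \<notin> edges (disjoint_union G H)"
proof -
  have "{Inl a, Inl b} \<notin> (\<lambda>e. Inr ` e) ` edges H" "{Inr c, Inr d} \<notin> (\<lambda>e. Inl ` e) ` edges G"
    by auto
  then show "{Inl a, Inl b} \<in> edges (disjoint_union G H) \<longleftrightarrow> {a, b} \<in> edges G"
    "{Inr c, Inr d} \<in> edges (disjoint_union G H) \<longleftrightarrow> {c, d} \<in> edges H"
    using pair_in_image_iff[of Inl a b "edges G"] pair_in_image_iff[of Inr c d "edges H"]
    by (simp_all add: disjoint_union_def)
qed (auto simp: disjoint_union_def)

lemma edge_graph_join:
  "{Inl a, Inl b} \<in> edges (graph_join G H) \<longleftrightarrow> {a, b} \<in> edges G"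
  "{Inr c, Inr d} \<in> edges (graph_join G H) \<longleftrightarrow> {c, d} \<in> edges H"
  "{Inl a, Inr d} \<in> edges (graph_join G H) \<longleftrightarrow> a \<in> verts G \<and> d \<in> verts H"
  "{Inr c, Inl b} \<in> edges (graph_join G H) \<longleftrightarrow> b \<in> verts G \<and> c \<in> verts H"
  by (auto simp: graph_join_def edge_disjoint_union doubleton_eq_iff)

lemma edge_disjoint_Union:
  "{(i, a), (j, b)} \<in> edges (disjoint_Union I G) \<longleftrightarrow> i = j \<and> i \<in> I \<and> {a, b} \<in> edges (G i)"
proof -
  have "i = j \<and> i = l" if "{(i, a), (j, b)} \<in> (\<lambda>e. Pair l ` e) ` E" for l and E :: "'b set set"
  proof -
    from that obtain e where e: "{(i, a), (j, b)} = Pair l ` e" by blast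
    have "(i, a) \<in> Pair l ` e" "(j, b) \<in> Pair l ` e" unfolding e[symmetric] by auto
    then show ?thesis by auto
  qed
  moreover have "{(i, a), (i, b)} \<in> (\<lambda>e. Pair i ` e) ` edges (G i) \<longleftrightarrow> {a, b} \<in> edges (G i)"
    by (rule pair_in_image_iff) (auto simp: inj_on_def)
  ultimately show ?thesis unfolding disjoint_Union_def by fastforce
qed

lemma edge_complete_graph: "{a, b} \<in> edges (complete_graph m) \<longleftrightarrow> a < m \<and> b < m \<and> a \<noteq> b"
  by (auto simp: complete_graph_def complete_on_def edge_in_all_edges)

lemma edge_complete_bipartite:
  "{Inl a, Inl b} \<notin> edges (complete_bipartite p q)"
  "{Inr c, Inr d} \<notin> edges (complete_bipartite p q)"
  "{Inl a, Inr d} \<in> edges (complete_bipartite p q) \<longleftrightarrow> a < p \<and> d < q"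
  "{Inr c, Inl b} \<in> edges (complete_bipartite p q) \<longleftrightarrow> b < p \<and> c < q"
  by (auto simp: complete_bipartite_def doubleton_eq_iff)

lemma simple_complete_graph: "simple_graph (complete_graph m)"
  by (simp add: simple_graph_def complete_graph_def complete_on_def)

lemma simple_complete_bipartite: "simple_graph (complete_bipartite p q)"
  by (auto simp: simple_graph_def complete_bipartite_def all_edges_def)

lemma image_all_edges:
  assumes "e \<in> all_edges V" "inj h" "h ` V \<subseteq> W"
  shows "h ` e \<in> all_edges W"
proof -
  from assms(1) obtain u v where "e = {u, v}" "u \<in> V" "v \<in> V" "u \<noteq> v"
    by (auto simp: all_edges_def)
  then show ?thesis using assms(2,3) by (auto simp: edge_in_all_edges inj_eq)
qed

lemma simple_disjoint_union:
  assumes "simple_graph G" "simple_graph H"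
  shows "simple_graph (disjoint_union G H)"
proof -
  have "Inl ` e \<in> all_edges (verts G <+> verts H)" if "e \<in> edges G" for e
    using that assms(1) by (intro image_all_edges[of _ "verts G"]) (auto simp: simple_graph_def)
  moreover have "Inr ` e \<in> all_edges (verts G <+> verts H)" if "e \<in> edges H" for e
    using that assms(2) by (intro image_all_edges[of _ "verts H"]) (auto simp: simple_graph_def)
  ultimately show ?thesis
    using assms by (auto simp: simple_graph_def disjoint_union_def)
qed

lemma simple_disjoint_Union:
  assumes "finite I" "\<And>i. i \<in> I \<Longrightarrow> simple_graph (G i)"
  shows "simple_graph (disjoint_Union I G)"
proof -
  have "Pair i ` e \<in> all_edges (SIGMA i:I. verts (G i))" if "i \<in> I" "e \<in> edges (G i)" for i e
    using that assms(2)[OF that(1)]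
    by (intro image_all_edges[of _ "verts (G i)"]) (auto simp: simple_graph_def inj_on_def)
  then show ?thesis
    using assms by (auto simp: simple_graph_def disjoint_Union_def intro!: finite_SigmaI)
qed

lemma simple_graph_join:
  assumes "simple_graph G" "simple_graph H"
  shows "simple_graph (graph_join G H)"
  using simple_disjoint_union[OF assms]
  by (auto simp: simple_graph_def graph_join_def disjoint_union_def edge_in_all_edges)

section \<open>The disjoint unions of cliques and bipartite graphs joined with a clique\<close>

definition model_graph ::
  "nat \<Rightarrow> nat \<Rightarrow> nat \<Rightarrow> (nat \<Rightarrow> nat) \<Rightarrow> (nat \<Rightarrow> nat) \<Rightarrow> nat
     \<Rightarrow> (((nat + nat) + nat \<times> (nat + nat)) + nat) sgraph" where
  "model_graph s1 s2 k p q r =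
     graph_join
       (disjoint_union
          (disjoint_union (complete_graph s1) (complete_graph s2))
          (disjoint_Union {..<k} (\<lambda>i. complete_bipartite (p i) (q i))))
       (complete_graph r)"

fun model_colour :: "((nat + nat) + nat \<times> (nat + nat)) + nat \<Rightarrow> nat colour" where
  "model_colour (Inl (Inl (Inl _))) = Clique True"
| "model_colour (Inl (Inl (Inr _))) = Clique False"
| "model_colour (Inl (Inr (n, Inl _))) = Part n True"
| "model_colour (Inl (Inr (n, Inr _))) = Part n False"
| "model_colour (Inr _) = Dominating"

lemma simple_model_graph: "simple_graph (model_graph s1 s2 k p q r)"
  unfolding model_graph_def
  by (intro simple_graph_join simple_disjoint_union simple_disjoint_Union
      simple_complete_graph simple_complete_bipartite finite_lessThan)

lemma verts_graph_constructions:
  "verts (complete_graph m) = {..<m}"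
  "verts (complete_bipartite p q) = {..<p} <+> {..<q}"
  "verts (disjoint_union G H) = verts G <+> verts H"
  "verts (disjoint_Union I K) = (SIGMA i:I. verts (K i))"
  "verts (graph_join G H) = verts G <+> verts H"
  by (simp_all add: graph_join_def disjoint_union_def disjoint_Union_def
      complete_graph_def complete_on_def complete_bipartite_def)

lemma verts_model_graph:
  "verts (model_graph s1 s2 k p q r) =
     (({..<s1} <+> {..<s2}) <+> (SIGMA i:{..<k}. {..<p i} <+> {..<q i})) <+> {..<r}"
  by (simp add: model_graph_def verts_graph_constructions)

lemma model_graph_coloured:
  "model_graph s1 s2 k p q r = coloured_graph (verts (model_graph s1 s2 k p q r)) model_colour"
    (is "?M = coloured_graph ?W _")
proof -
  have "edges ?M = edges (coloured_graph ?W model_colour)"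
  proof (rule edge_sets_eqI)
    show "edges ?M \<subseteq> all_edges ?W"
      using simple_model_graph by (auto simp: simple_graph_def)
    show "edges (coloured_graph ?W model_colour) \<subseteq> all_edges ?W"
      by (rule edges_coloured_graph_subset)
    fix x y assume xy: "x \<in> ?W" "y \<in> ?W" "x \<noteq> y"
    show "{x, y} \<in> edges ?M \<longleftrightarrow> {x, y} \<in> edges (coloured_graph ?W model_colour)"
      using xy unfolding edge_coloured_graph_iff
      unfolding model_graph_def
      by (cases x rule: model_colour.cases; cases y rule: model_colour.cases;
          simp add: adj_def edge_graph_join edge_disjoint_union edge_disjoint_Union
            edge_complete_graph edge_complete_bipartite verts_graph_constructions; blast?)
  qed
  then show ?thesis by (metis sgraph.expand verts_coloured_graph)
qed

text \<open>
  Choose a bijection between the fibres over each value and glue these: the fibres partition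
  both sets.
\<close>

lemma bij_betw_fibres:
  fixes f :: "'a \<Rightarrow> 'c" and g :: "'b \<Rightarrow> 'c"
  assumes "finite V" "finite W"
    and "\<And>l. card {v \<in> V. f v = l} = card {w \<in> W. g w = l}"
  obtains h where "bij_betw h V W" "\<And>v. v \<in> V \<Longrightarrow> g (h v) = f v"
proof -
  have "\<exists>h. bij_betw h {v \<in> V. f v = l} {w \<in> W. g w = l}" for l
    using assms by (intro finite_same_card_bij) auto
  then obtain H where H: "\<And>l. bij_betw (H l) {v \<in> V. f v = l} {w \<in> W. g w = l}"
    by metis
  define h where "h v = H (f v) v" for v
  have hW: "h v \<in> W \<and> g (h v) = f v" if "v \<in> V" for v
    using bij_betwE[OF H[of "f v"]] that by (auto simp: h_def)
  have "bij_betw h V W"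
    unfolding bij_betw_def
  proof
    show "inj_on h V"
    proof (rule inj_onI)
      fix u v assume uv: "u \<in> V" "v \<in> V" "h u = h v"
      then have "f u = f v" using hW by metis
      then show "u = v"
        using uv bij_betw_imp_inj_on[OF H[of "f u"]] by (auto simp: h_def inj_on_def)
    qed
    show "h ` V = W"
    proof
      show "h ` V \<subseteq> W" using hW by auto
      show "W \<subseteq> h ` V"
      proof
        fix w assume "w \<in> W"
        then have "w \<in> H (g w) ` {v \<in> V. f v = g w}"
          using bij_betw_imp_surj_on[OF H[of "g w"]] by auto
        then obtain v where "v \<in> V" "f v = g w" "w = H (g w) v" by blast
        then show "w \<in> h ` V" unfolding h_def by (intro image_eqI[of _ _ v]) simp_all
      qed
    qed
  qed
  with hW that show ?thesis by blast
qed

lemma coloured_graph_iso: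
  assumes "bij_betw h V W" "\<And>u v. u \<in> V \<Longrightarrow> v \<in> V \<Longrightarrow> adj (g (h u)) (g (h v)) = adj (f u) (f v)"
  shows "graph_iso (coloured_graph V f) (coloured_graph W g)"
proof -
  have W: "W = h ` V" using assms(1) by (simp add: bij_betw_def)
  have inj: "h u = h v \<longleftrightarrow> u = v" if "u \<in> V" "v \<in> V" for u v
    using assms(1) that by (auto simp: bij_betw_def inj_on_def)
  have "edges (coloured_graph W g) = (\<lambda>e. h ` e) ` edges (coloured_graph V f)"
  proof (intro equalityI subsetI)
    fix e assume "e \<in> edges (coloured_graph W g)"
    then obtain u v where "e = {h u, h v}" "u \<in> V" "v \<in> V" "h u \<noteq> h v" "adj (g (h u)) (g (h v))"
      by (auto simp: coloured_graph_def W)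
    then have "e = h ` {u, v}" "{u, v} \<in> edges (coloured_graph V f)"
      using assms(2) by (auto simp: edge_coloured_graph_iff)
    then show "e \<in> (\<lambda>e. h ` e) ` edges (coloured_graph V f)" by blast
  next
    fix e assume "e \<in> (\<lambda>e. h ` e) ` edges (coloured_graph V f)"
    then obtain u v where "e = {h u, h v}" "u \<in> V" "v \<in> V" "u \<noteq> v" "adj (f u) (f v)"
      by (auto simp: coloured_graph_def)
    then show "e \<in> edges (coloured_graph W g)"
      using inj assms(2) by (auto simp: edge_coloured_graph_iff W)
  qed
  then show ?thesis using assms(1) by (auto simp: graph_iso_def)
qed

text \<open>The colours of the model are pulled back along the isomorphism.\<close>

lemma graph_iso_model_imp_coloured:
  assumes "simple_graph C" "graph_iso C (model_graph s1 s2 k p q r)"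
  obtains f :: "'a \<Rightarrow> nat colour" where "C = coloured_graph (verts (C :: 'a sgraph)) f"
proof -
  let ?M = "model_graph s1 s2 k p q r"
  from assms(2) obtain h where h: "bij_betw h (verts C) (verts ?M)"
    and E: "edges ?M = (\<lambda>e. h ` e) ` edges C"
    by (auto simp: graph_iso_def)
  have sub: "edges C \<subseteq> all_edges (verts C)" using assms(1) by (simp add: simple_graph_def)
  have "edges C = edges (coloured_graph (verts C) (model_colour \<circ> h))"
  proof (rule edge_sets_eqI[OF sub edges_coloured_graph_subset])
    fix u v assume uv: "u \<in> verts C" "v \<in> verts C" "u \<noteq> v"
    have inj: "inj_on h (verts C)" using h by (simp add: bij_betw_def)
    have "{u, v} \<in> edges C \<longleftrightarrow> h ` {u, v} \<in> (\<lambda>e. h ` e) ` edges C"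
    proof
      assume "h ` {u, v} \<in> (\<lambda>e. h ` e) ` edges C"
      then obtain e where e: "e \<in> edges C" "h ` {u, v} = h ` e" by blast
      then have "e \<subseteq> verts C" using sub by (auto simp: all_edges_def)
      then show "{u, v} \<in> edges C"
        using e uv inj_on_image_eq_iff[OF inj, of "{u, v}" e] by simp
    qed blast
    also have "\<dots> \<longleftrightarrow> {h u, h v} \<in> edges ?M" by (simp add: E)
    also have "\<dots> \<longleftrightarrow> adj (model_colour (h u)) (model_colour (h v))"
      using uv bij_betwE[OF h] inj
      by (subst model_graph_coloured) (auto simp: edge_coloured_graph_iff inj_on_eq_iff)
    also have "\<dots> \<longleftrightarrow> {u, v} \<in> edges (coloured_graph (verts C) (model_colour \<circ> h))"
      using uv by (simp add: edge_coloured_graph_iff)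
    finally show "{u, v} \<in> edges C
        \<longleftrightarrow> {u, v} \<in> edges (coloured_graph (verts C) (model_colour \<circ> h))" .
  qed
  then have "C = coloured_graph (verts C) (model_colour \<circ> h)"
    by (metis sgraph.expand verts_coloured_graph)
  then show ?thesis using that by blast
qed

lemma card_model_colour:
  "card {w \<in> verts (model_graph s1 s2 k p q r). model_colour w = l} =
     (case l of Dominating \<Rightarrow> r | Clique b \<Rightarrow> if b then s1 else s2
        | Part n b \<Rightarrow> if n < k then if b then p n else q n else 0)"
    (is "card ?L = ?c")
proof -
  have *: "card (h ` {..<m}) = m" if "inj h" for h and m :: nat
    using that by (simp add: card_image inj_on_subset)
  consider "l = Dominating" | "l = Clique True" | "l = Clique False"
    | n where "l = Part n True" | n where "l = Part n False"
    by (cases l; metis (full_types))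
  then show ?thesis
  proof cases
    case 1
    have "?L = Inr ` {..<r}"
      by (auto simp: verts_model_graph 1 elim: model_colour.elims)
    with 1 show ?thesis by (simp add: *)
  next
    case 2
    have "?L = (Inl \<circ> Inl \<circ> Inl) ` {..<s1}"
      by (auto simp: verts_model_graph 2 elim: model_colour.elims)
    with 2 show ?thesis by (simp only: *) (simp add: inj_on_def *)
  next
    case 3
    have "?L = (Inl \<circ> Inl \<circ> Inr) ` {..<s2}"
      by (auto simp: verts_model_graph 3 elim: model_colour.elims)
    with 3 show ?thesis by (simp add: inj_on_def *)
  next
    case (4 n)
    have "?L = (\<lambda>x. Inl (Inr (n, Inl x))) ` {..<if n < k then p n else 0}"
      by (auto simp: verts_model_graph 4 elim: model_colour.elims)
    then have "card ?L = (if n < k then p n else 0)"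
      by (simp only:) (rule *, simp add: inj_on_def)
    with 4 show ?thesis by simp
  next
    case (5 n)
    have "?L = (\<lambda>x. Inl (Inr (n, Inr x))) ` {..<if n < k then q n else 0}"
      by (auto simp: verts_model_graph 5 elim: model_colour.elims)
    then have "card ?L = (if n < k then q n else 0)"
      by (simp only:) (rule *, simp add: inj_on_def)
    with 5 show ?thesis by simp
  qed
qed

text \<open>
  The sizes of the colour classes serve as the parameters of the model. The indices that occur
  are first renumbered as \<open>0, \<dots>, k - 1\<close>: that each of them is used by some vertex is exactly the
  condition \<open>p i + q i > 0\<close>.
\<close>

lemma coloured_imp_graph_iso_model:
  fixes f :: "'a \<Rightarrow> 'b colour"
  assumes "finite V"
  shows "\<exists>k s1 s2 p q r. (\<forall>i<k. p i + q i > 0)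
           \<and> graph_iso (coloured_graph V f) (model_graph s1 s2 k p q r)"
proof -
  define I where "I = {n. \<exists>v\<in>V. \<exists>b. f v = Part n b}"
  have "I \<subseteq> (\<lambda>v. case f v of Part n b \<Rightarrow> n | _ \<Rightarrow> undefined) ` V"
    by (force simp: I_def)
  then have "finite I" using assms finite_surj by blast
  then obtain ix where ix: "bij_betw ix I {0..<card I}"
    using ex_bij_betw_finite_nat by blast
  define g where "g v = (case f v of Dominating \<Rightarrow> Dominating | Clique b \<Rightarrow> Clique b
     | Part n b \<Rightarrow> Part (ix n) b)" for v
  define count where "count l = card {v \<in> V. g v = l}" for l
  let ?p = "\<lambda>n. count (Part n True)" and ?q = "\<lambda>n. count (Part n False)"
  let ?M = "model_graph (count (Clique True)) (count (Clique False)) (card I) ?p ?q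
    (count Dominating)"
  have adj_g: "adj (g u) (g v) = adj (f u) (f v)" if "u \<in> V" "v \<in> V" for u v
  proof -
    have "n \<in> I" if "w \<in> V" "f w = Part n b" for w n b
      using that by (auto simp: I_def)
    then have *: "f u = Part m b \<Longrightarrow> f v = Part n c \<Longrightarrow> ix m = ix n \<longleftrightarrow> m = n" for m n b c
      using inj_on_eq_iff[OF bij_betw_imp_inj_on[OF ix]] \<open>u \<in> V\<close> \<open>v \<in> V\<close> by metis
    show ?thesis
    proof (cases "\<exists>m n b c. f u = Part m b \<and> f v = Part n c")
      case True
      then obtain m n b c where "f u = Part m b" "f v = Part n c" by blast
      with *[OF this] show ?thesis by (auto simp: adj_def g_def)
    qed (auto simp: adj_def g_def split: colour.splits)
  qed
  have used: "\<exists>v\<in>V. g v = Part i True \<or> g v = Part i False" if i: "i < card I" for i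
  proof -
    from i have "i \<in> ix ` I" using bij_betw_imp_surj_on[OF ix] by simp
    then obtain n v c where "i = ix n" "v \<in> V" "f v = Part n c" by (auto simp: I_def)
    then show ?thesis by (intro bexI[of _ v]) (auto simp: g_def)
  qed
  have pos: "?p i + ?q i > 0" if "i < card I" for i
    using used[OF that] assms by (auto simp: count_def card_gt_0_iff)
  have "count l = card {w \<in> verts ?M. model_colour w = l}" for l
  proof -
    have "count (Part n b) = 0" if "\<not> n < card I" for n b
    proof -
      have "g v \<noteq> Part n b" if "v \<in> V" for v
        using \<open>\<not> n < card I\<close> that bij_betwE[OF ix]
        by (force simp: g_def I_def split: colour.splits)
      then have "{v \<in> V. g v = Part n b} = {}" by blast
      then show ?thesis by (simp only: count_def card.empty)
    qed
    then show ?thesis by (cases l) (auto simp: card_model_colour)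
  qed
  then have "\<And>l. card {v \<in> V. g v = l} = card {w \<in> verts ?M. model_colour w = l}"
    unfolding count_def .
  moreover have "finite (verts ?M)" using simple_model_graph by (auto simp: simple_graph_def)
  ultimately obtain h where h: "bij_betw h V (verts ?M)" "\<And>v. v \<in> V \<Longrightarrow> model_colour (h v) = g v"
    using bij_betw_fibres[OF assms, of "verts ?M" g model_colour] by blast
  then have "graph_iso (coloured_graph V f) (coloured_graph (verts ?M) model_colour)"
    using adj_g by (intro coloured_graph_iso) auto
  then have "graph_iso (coloured_graph V f) ?M"
    by (simp only: model_graph_coloured[symmetric])
  with pos show ?thesis by (intro exI conjI allI impI)
qed

section \<open>Zero patterns of symmetric matrices of rank at most two\<close>

text \<open>
  All consequences of low rank are drawn from this one. When two of the rows coincide as functions, the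
  set of rows is smaller than three and says nothing, but then \<open>1\<close> and \<open>- 1\<close> are coefficients.
\<close>

lemma three_rows_dependent:
  assumes "mat_rank V A \<le> 2" "finite V" "i \<in> V" "j \<in> V" "k \<in> V"
  obtains a b c where "a \<noteq> 0 \<or> b \<noteq> 0 \<or> c \<noteq> 0" "\<And>m. a * A i m + b * A j m + c * A k m = 0"
proof (cases "A i = A j \<or> A i = A k \<or> A j = A k")
  case True
  then consider "A i = A j" | "A i = A k" | "A j = A k" by blast
  then show ?thesis
  proof cases
    case 1
    then show ?thesis by (intro that[of 1 "-1" 0]) simp_all
  next
    case 2
    then show ?thesis by (intro that[of 1 0 "-1"]) simp_all
  next
    case 3
    then show ?thesis by (intro that[of 0 1 "-1"]) simp_all
  qed
next
  case False
  let ?T = "{A i, A j, A k}"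
  have card: "card ?T = 3" using False by auto
  obtain B where B: "B \<subseteq> A ` V" "A ` V \<subseteq> fun_space.span B" "card B = fun_space.dim (A ` V)"
    using fun_space.basis_exists[of "A ` V"] by metis
  have "finite B" using B(1) assms(2) finite_surj by blast
  have "fun_space.dependent ?T"
  proof (rule ccontr)
    assume "\<not> fun_space.dependent ?T"
    then have "card ?T \<le> card B"
      using fun_space.independent_span_bound[OF \<open>finite B\<close>, of ?T] B(2) assms(3-5) by auto
    then show False using card B(3) assms(1) by (simp add: mat_rank_def)
  qed
  then obtain u x where u: "x \<in> ?T" "u x \<noteq> 0" "(\<Sum>v\<in>?T. (\<lambda>m. u v * v m)) = 0"
    using fun_space.dependent_finite[of ?T] by auto
  have "(\<lambda>m. u (A i) * A i m) + ((\<lambda>m. u (A j) * A j m) + (\<lambda>m. u (A k) * A k m)) = 0"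
    using u(3) False by simp
  then have "u (A i) * A i m + u (A j) * A j m + u (A k) * A k m = 0" for m
    by (simp add: fun_eq_iff add.assoc)
  with u(1,2) show ?thesis by (intro that[of "u (A i)" "u (A j)" "u (A k)"]) auto
qed

text \<open>A nonzero factor, so that this is an equivalence relation on all rows, zero rows included.\<close>

definition parallel_rows :: "('a \<Rightarrow> 'a \<Rightarrow> real) \<Rightarrow> 'a \<Rightarrow> 'a \<Rightarrow> bool" where
  "parallel_rows A i j \<longleftrightarrow> (\<exists>c. c \<noteq> 0 \<and> (\<forall>m. A i m = c * A j m))"

lemma parallel_rows_refl: "parallel_rows A i i"
  unfolding parallel_rows_def by (rule exI[of _ 1]) simp

lemma parallel_rows_sym: "parallel_rows A i j \<Longrightarrow> parallel_rows A j i"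
  unfolding parallel_rows_def by (metis divide_inverse_commute mult.commute
      nonzero_eq_divide_eq nonzero_imp_inverse_nonzero)

lemma parallel_rows_trans:
  "parallel_rows A i j \<Longrightarrow> parallel_rows A j k \<Longrightarrow> parallel_rows A i k"
  unfolding parallel_rows_def by (metis mult.assoc mult_eq_0_iff)

lemma dependent_rows_parallel:
  assumes "a \<noteq> 0 \<or> b \<noteq> 0" "\<And>m. a * A i m + b * A j m = 0" "A i \<noteq> (\<lambda>m. 0)" "A j \<noteq> (\<lambda>m. 0)"
  shows "parallel_rows A i j"
proof -
  obtain m n where mn: "A i m \<noteq> 0" "A j n \<noteq> 0" using assms(3,4) by (auto simp: fun_eq_iff)
  have "a \<noteq> 0" "b \<noteq> 0" using assms(1) assms(2)[of m] assms(2)[of n] mn by auto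
  have "A i m = (- b / a) * A j m" for m
    using assms(2)[of m] \<open>a \<noteq> 0\<close> by (simp add: field_simps)
  then show ?thesis
    unfolding parallel_rows_def using \<open>a \<noteq> 0\<close> \<open>b \<noteq> 0\<close> by (intro exI[of _ "- b / a"]) auto
qed

text \<open>
  A line has at most one orthogonal line. If rows \<open>j\<close> and \<open>k\<close> were not parallel, they would span
  all rows; since both vanish at \<open>i\<close>, column \<open>i\<close> would vanish, and with it row \<open>i\<close>.
\<close>

lemma orthogonal_rows_parallel:
  assumes "mat_rank V A \<le> 2" "finite V" "\<And>m. m \<notin> V \<Longrightarrow> A i m = 0"
    and sym: "\<And>u v. A u v = A v u"
    and V: "i \<in> V" "j \<in> V" "k \<in> V"
    and nz: "A i \<noteq> (\<lambda>m. 0)" "A j \<noteq> (\<lambda>m. 0)" "A k \<noteq> (\<lambda>m. 0)"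
    and orth: "A i j = 0" "A i k = 0"
  shows "parallel_rows A j k"
proof (rule ccontr)
  assume np: "\<not> parallel_rows A j k"
  have "A i m = 0" if m: "m \<in> V" for m
  proof -
    obtain a b c where abc: "a \<noteq> 0 \<or> b \<noteq> 0 \<or> c \<noteq> 0"
      "\<And>n. a * A j n + b * A k n + c * A m n = 0"
      using three_rows_dependent[OF assms(1,2) V(2,3) m] by metis
    have "c \<noteq> 0" using dependent_rows_parallel[of a b A j k] abc nz np by auto
    moreover have "c * A i m = 0" using abc(2)[of i] orth sym by simp
    ultimately show ?thesis by simp
  qed
  then show False using nz(1) assms(3) by blast
qed

text \<open>
  There are at most two self-orthogonal lines. For three of them the
  entries \<open>A i j\<close>, \<open>A i k\<close>, \<open>A j k\<close> would all be nonzero by the previous lemma, and the principal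
  minor on \<open>i\<close>, \<open>j\<close>, \<open>k\<close>, whose diagonal is zero, would be \<open>2 * A i j * A i k * A j k\<close>; but three rows are
  dependent.
\<close>

lemma isotropic_rows_parallel:
  assumes rank: "mat_rank V A \<le> 2" "finite V" and supp: "\<And>u v. v \<notin> V \<Longrightarrow> A u v = 0"
    and sym: "\<And>u v. A u v = A v u"
    and V: "i \<in> V" "j \<in> V" "k \<in> V"
    and nz: "A i \<noteq> (\<lambda>m. 0)" "A j \<noteq> (\<lambda>m. 0)" "A k \<noteq> (\<lambda>m. 0)"
    and iso: "A i i = 0" "A j j = 0" "A k k = 0"
    and np: "\<not> parallel_rows A i k" "\<not> parallel_rows A j k"
  shows "parallel_rows A i j"
proof (rule ccontr)
  assume np': "\<not> parallel_rows A i j"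
  have x: "A i j \<noteq> 0" "A i k \<noteq> 0" "A j k \<noteq> 0"
    using orthogonal_rows_parallel[OF rank supp sym V(1) V(1) V(2) nz(1,1,2)]
      orthogonal_rows_parallel[OF rank supp sym V(1) V(1) V(3) nz(1,1,3)]
      orthogonal_rows_parallel[OF rank supp sym V(2) V(2) V(3) nz(2,2,3)] iso np np' by auto
  obtain a b c where abc: "a \<noteq> 0 \<or> b \<noteq> 0 \<or> c \<noteq> 0"
    "\<And>n. a * A i n + b * A j n + c * A k n = 0"
    using three_rows_dependent[OF rank V] by metis
  have e: "b * A i j + c * A i k = 0" "a * A i j + c * A j k = 0" "a * A i k + b * A j k = 0"
    using abc(2)[of i] abc(2)[of j] abc(2)[of k] iso sym by auto
  \<comment> \<open>The combination of the three equations that eliminates \<open>b\<close> and \<open>c\<close>.\<close>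
  have "2 * a * A i j * A i k
      = A i k * (a * A i j + c * A j k) + A i j * (a * A i k + b * A j k)
        - A j k * (b * A i j + c * A i k)"
    by (simp add: algebra_simps)
  then have "a = 0" using e x by simp
  then show False using e x abc(1) by simp
qed

text \<open>
  A nonzero row that is not self-orthogonal lies in a block: the rows parallel or orthogonal to it.
  The block itself is used as the index of the bipartite graph, and the side is decided by
  being parallel to a chosen member of the block. Self-orthogonal rows are likewise
  compared with one chosen self-orthogonal row \<open>a\<close>: those not parallel to it are parallel to each
  other.
\<close>

lemma rank_two_imp_coloured:
  fixes H :: "'a sgraph"
  assumes "simple_graph H" "A \<in> sym_matrices H" "mat_rank (verts H) A \<le> 2"
  obtains f :: "'a \<Rightarrow> 'a set colour" where "graph_compl H = coloured_graph (verts H) f"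
proof -
  let ?V = "verts H" and ?par = "parallel_rows A"
  have fin: "finite ?V" using assms(1) by (simp add: simple_graph_def)
  have supp: "A u v = 0" if "u \<notin> ?V \<or> v \<notin> ?V" for u v
    using assms(2) that by (auto simp: sym_matrices_def matrices_on_def)
  have sym: "A u v = A v u" for u v
    using assms(2) supp by (cases "u \<in> ?V \<and> v \<in> ?V") (auto simp: sym_matrices_def)
  define V' where "V' = {v \<in> ?V. A v \<noteq> (\<lambda>m. 0)}"
  have orth_par: "?par j k" if "i \<in> V'" "j \<in> V'" "k \<in> V'" "A i j = 0" "A i k = 0" for i j k
    using orthogonal_rows_parallel[OF assms(3) fin _ sym, of i j k] supp that
    by (auto simp: V'_def)
  have iso_par: "?par i j" if "i \<in> V'" "j \<in> V'" "k \<in> V'" "A i i = 0" "A j j = 0" "A k k = 0"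
    "\<not> ?par i k" "\<not> ?par j k" for i j k
    using isotropic_rows_parallel[OF assms(3) fin _ sym, of i j k] supp that
    by (auto simp: V'_def)
  have par_orth: "A i k = 0 \<longleftrightarrow> A j k = 0" if "?par i j" for i j k
    using that by (auto simp: parallel_rows_def)
  note par = parallel_rows_refl[of A] parallel_rows_sym[of A] parallel_rows_trans[of A]

  define a where "a = (SOME v. v \<in> V' \<and> A v v = 0)"
  have a: "a \<in> V' \<and> A a a = 0" if "v \<in> V'" "A v v = 0" for v
    unfolding a_def by (rule someI[of _ v]) (use that in blast)
  define block where "block v = {u \<in> V'. ?par u v \<or> A u v = 0}" for v
  define rep where "rep B = (SOME v. v \<in> B)" for B :: "'a set"
  have rep: "rep (block v) \<in> V'" "?par v (rep (block v)) \<or> A v (rep (block v)) = 0"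
    if "v \<in> V'" for v
  proof -
    have "v \<in> block v" using that par(1) by (simp add: block_def)
    then have "rep (block v) \<in> block v" unfolding rep_def by (rule someI)
    then have "rep (block v) \<in> V'" "?par (rep (block v)) v \<or> A (rep (block v)) v = 0"
      by (simp_all add: block_def)
    then show "rep (block v) \<in> V'" "?par v (rep (block v)) \<or> A v (rep (block v)) = 0"
      using par(2) sym by metis+
  qed
  define f where "f v = (if A v = (\<lambda>m. 0) then Dominating
     else if A v v = 0 then Clique (?par v a)
     else Part (block v) (?par v (rep (block v))))" for v

  have "adj (f u) (f v) \<longleftrightarrow> A u v = 0" if uv: "u \<in> ?V" "v \<in> ?V" for u v
  proof (cases "A u = (\<lambda>m. 0) \<or> A v = (\<lambda>m. 0)")
    case True
    then have "A u v = 0" using sym[of u v] by auto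
    with True show ?thesis by (auto simp: adj_def f_def)
  next
    case False
    then have V: "u \<in> V'" "v \<in> V'" using uv by (auto simp: V'_def)
    consider "A u u = 0" "A v v = 0" | "A u u \<noteq> 0" "A v v \<noteq> 0"
      | "A u u = 0 \<longleftrightarrow> A v v \<noteq> 0" by blast
    then show ?thesis
    proof cases
      case 1
      have "A u v = 0 \<longleftrightarrow> ?par u v"
        using orth_par[of u u v] par_orth[of u v v] V 1 by blast
      also have "\<dots> \<longleftrightarrow> (?par u a \<longleftrightarrow> ?par v a)"
        using iso_par[of u v a] a[OF V(1)] V 1 par by blast
      finally show ?thesis using False 1 by (auto simp: adj_def f_def)
    next
      case 3
      have "A u v \<noteq> 0"
      proof
        assume 0: "A u v = 0"
        then have "?par u v" using orth_par[of u u v] orth_par[of v u v] V sym[of u v] 3 by auto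
        then show False using 0 3 par_orth[of u v u] par_orth[of u v v] sym[of u v] by auto
      qed
      then show ?thesis using False 3 by (auto simp: adj_def f_def)
    next
      case 2
      have not_both: "\<not> (?par x y \<and> A x y = 0)" if "A y y \<noteq> 0" for x y
        using par_orth[of x y y] that by blast
      show ?thesis
      proof
        assume 0: "A u v = 0"
        have "block u = block v"
        proof -
          have "?par x u \<longleftrightarrow> A x v = 0" "?par x v \<longleftrightarrow> A x u = 0" if "x \<in> V'" for x
            using orth_par[of v x u] orth_par[of u x v] par_orth[of x u v] par_orth[of x v u]
              0 that V sym by metis+
          then show ?thesis by (auto simp: block_def)
        qed
        moreover
        let ?r = "rep (block u)"
        have "?par u ?r \<longleftrightarrow> \<not> ?par v ?r"
        proof -
          have "\<not> ?par u v" using not_both[of v u] 0 2 by blast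
          moreover have "?par u v" if "A u ?r = 0" "A v ?r = 0"
            using orth_par[of ?r u v] rep(1)[OF V(1)] V that sym by metis
          ultimately show ?thesis
            using rep(2)[OF V(1)] rep(2)[OF V(2)] \<open>block u = block v\<close> par by metis
        qed
        ultimately show "adj (f u) (f v)" using False 2 by (auto simp: adj_def f_def)
      next
        assume "adj (f u) (f v)"
        then have eq: "block u = block v"
          and opp: "?par u (rep (block u)) \<longleftrightarrow> \<not> ?par v (rep (block u))"
          using False 2 by (auto simp: adj_def f_def)
        show "A u v = 0"
          using rep(2)[OF V(1)] rep(2)[OF V(2)] eq opp
            par_orth[of u "rep (block u)" v] par_orth[of v "rep (block u)" u]
            sym[of u v] sym[of u "rep (block u)"] sym[of v "rep (block u)"] by auto
      qed
    qed
  qed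
  moreover have "{u, v} \<in> edges H \<longleftrightarrow> A u v \<noteq> 0" if "u \<in> ?V" "v \<in> ?V" "u \<noteq> v" for u v
    using assms(2) that by (auto simp: sym_matrices_def)
  ultimately have "edges (graph_compl H) = edges (coloured_graph ?V f)"
    by (intro edge_sets_eqI[of _ ?V] edges_coloured_graph_subset)
      (auto simp: graph_compl_def edge_coloured_graph_iff edge_in_all_edges)
  then have "graph_compl H = coloured_graph ?V f"
    by (intro sgraph.expand) (simp add: graph_compl_def)
  then show ?thesis by (rule that)
qed

section \<open>Matrices of rank at most two from colours\<close>

fun colour_vector :: "nat colour \<Rightarrow> real \<times> real" where
  "colour_vector Dominating = (0, 0)"
| "colour_vector (Clique b) = (if b then (1, 0) else (0, 1))"
| "colour_vector (Part n b) = (1, if b then real (Suc n) else - real (Suc n))"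

text \<open>
  The second coordinates \<open>Suc n\<close> and \<open>- Suc n\<close> are never zero, so these vectors avoid the axes.
  Two vectors \<open>(1, s)\<close> and \<open>(1, t)\<close> are orthogonal iff \<open>s + t = 0\<close>.
\<close>

lemma adj_iff_orthogonal:
  "adj x y \<longleftrightarrow> fst (colour_vector x) * snd (colour_vector y)
     + snd (colour_vector x) * fst (colour_vector y) = 0"
  by (cases x; cases y) (auto simp: adj_def)

lemma coloured_imp_rank_two:
  fixes f :: "'a \<Rightarrow> nat colour"
  assumes "graph_compl H = coloured_graph (verts H) f"
  obtains A where "A \<in> sym_matrices H" "mat_rank (verts H) A \<le> 2"
proof -
  let ?V = "verts H"
  define x where "x v = (if v \<in> ?V then fst (colour_vector (f v)) else 0)" for v
  define y where "y v = (if v \<in> ?V then snd (colour_vector (f v)) else 0)" for v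
  define A where "A u v = x u * y v + y u * x v" for u v
  have "{u, v} \<in> edges H \<longleftrightarrow> A u v \<noteq> 0" if uv: "u \<in> ?V" "v \<in> ?V" "u \<noteq> v" for u v
  proof -
    have "{u, v} \<in> edges H \<longleftrightarrow> {u, v} \<notin> edges (graph_compl H)"
      using uv by (auto simp: graph_compl_def edge_in_all_edges)
    then show ?thesis
      using uv by (simp add: assms edge_coloured_graph_iff adj_iff_orthogonal A_def x_def y_def)
  qed
  then have "A \<in> sym_matrices H"
    by (auto simp: sym_matrices_def matrices_on_def A_def x_def y_def)
  moreover have "mat_rank ?V A \<le> 2"
  proof -
    have "A u \<in> fun_space.span {y, x}" for u
    proof -
      have "A u = (\<lambda>v. x u * y v) + (\<lambda>v. y u * x v)" by (auto simp: A_def)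
      then show ?thesis
        by (simp only:) (intro fun_space.span_add fun_space.span_scale fun_space.span_base; simp)
    qed
    then have "fun_space.dim (A ` ?V) \<le> card {y, x}"
      by (intro fun_space.dim_le_card) auto
    also have "\<dots> \<le> 2" by (simp add: card_insert_if)
    finally show ?thesis by (simp add: mat_rank_def)
  qed
  ultimately show ?thesis by (rule that)
qed

section \<open>Graphs and probe graphs of minimum rank at most two\<close>

lemma simple_graph_compl: "simple_graph H \<Longrightarrow> simple_graph (graph_compl H)"
  by (auto simp: simple_graph_def graph_compl_def)

lemma min_rank_two_iff_complement:
  assumes "simple_graph H"
  shows "(\<exists>A\<in>sym_matrices H. mat_rank (verts H) A \<le> 2) \<longleftrightarrow>
    (\<exists>k s1 s2 p q r. (\<forall>i<k. p i + q i > 0)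
       \<and> graph_iso (graph_compl H) (model_graph s1 s2 k p q r))"
proof
  assume "\<exists>A\<in>sym_matrices H. mat_rank (verts H) A \<le> 2"
  then obtain f :: "'a \<Rightarrow> 'a set colour" where "graph_compl H = coloured_graph (verts H) f"
    using rank_two_imp_coloured[OF assms] by metis
  then show "\<exists>k s1 s2 p q r. (\<forall>i<k. p i + q i > 0)
      \<and> graph_iso (graph_compl H) (model_graph s1 s2 k p q r)"
    using coloured_imp_graph_iso_model[of "verts H" f] assms by (simp add: simple_graph_def)
next
  assume "\<exists>k s1 s2 p q r. (\<forall>i<k. p i + q i > 0)
      \<and> graph_iso (graph_compl H) (model_graph s1 s2 k p q r)"
  then obtain k s1 s2 p q r where "graph_iso (graph_compl H) (model_graph s1 s2 k p q r)"
    by blast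
  then obtain f :: "'a \<Rightarrow> nat colour" where "graph_compl H = coloured_graph (verts (graph_compl H)) f"
    by (rule graph_iso_model_imp_coloured[OF simple_graph_compl[OF assms]])
  then have "graph_compl H = coloured_graph (verts H) f" by (simp add: graph_compl_def)
  then obtain A where "A \<in> sym_matrices H" "mat_rank (verts H) A \<le> 2"
    by (rule coloured_imp_rank_two)
  then show "\<exists>A\<in>sym_matrices H. mat_rank (verts H) A \<le> 2" by blast
qed

lemma probe_mr_le_iff:
  "probe_mr G N \<le> n \<longleftrightarrow> (\<exists>A\<in>probe_matrices G N. mat_rank (verts G) A \<le> n)"
proof
  have "\<exists>r. \<exists>A\<in>probe_matrices G N. mat_rank (verts G) A = r"
    using probe_matrices_nonempty by blast
  then have "\<exists>A\<in>probe_matrices G N. mat_rank (verts G) A = probe_mr G N"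
    unfolding probe_mr_def by (rule LeastI_ex)
  then show "probe_mr G N \<le> n \<Longrightarrow> \<exists>A\<in>probe_matrices G N. mat_rank (verts G) A \<le> n"
    by metis
next
  assume "\<exists>A\<in>probe_matrices G N. mat_rank (verts G) A \<le> n"
  then obtain A where "A \<in> probe_matrices G N" "mat_rank (verts G) A \<le> n" by blast
  moreover from this(1) have "probe_mr G N \<le> mat_rank (verts G) A"
    unfolding probe_mr_def by (intro Least_le) blast
  ultimately show "probe_mr G N \<le> n" by simp
qed

text \<open>
  From left to right \<open>S\<close> is \<open>F\<close>. Conversely the edges of \<open>H\<close> outside \<open>G\<close> are in the complement of \<open>G\<close>
  but not in that of \<open>H\<close>, so they belong to \<open>S\<close> and form \<open>F\<close>; here \<open>S\<close> may contain more than \<open>F\<close>.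
\<close>

lemma graph_compl_add_nonprobe_edges:
  fixes G :: "'a sgraph"
  assumes "probe_graph G N"
  shows "(\<exists>F \<in> Pow (all_edges N). H = Graph (verts G) (edges G \<union> F)) \<longleftrightarrow>
    simple_graph H \<and> (\<exists>S. S \<subseteq> edges (complete_on N) \<and> verts (graph_compl G) = verts H \<and>
       edges (graph_compl G) = edges (graph_compl H) \<union> S)" (is "?L \<longleftrightarrow> ?R")
proof -
  have G: "finite (verts G)" "edges G \<subseteq> all_edges (verts G)" and N: "N \<subseteq> verts G"
    and indep: "\<And>u v. u \<in> N \<Longrightarrow> v \<in> N \<Longrightarrow> {u, v} \<notin> edges G"
    using assms by (auto simp: probe_graph_def simple_graph_def)
  have NV: "all_edges N \<subseteq> all_edges (verts G)" using N by (auto simp: all_edges_def)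
  have disj: "all_edges N \<inter> edges G = {}" using indep by (auto simp: all_edges_def)
  show ?thesis
  proof
    assume ?L
    then obtain F where F: "F \<subseteq> all_edges N" "H = Graph (verts G) (edges G \<union> F)" by blast
    have "edges (graph_compl G) = edges (graph_compl H) \<union> F"
      using F NV disj by (auto simp: graph_compl_def)
    moreover have "simple_graph H" using F G NV by (auto simp: simple_graph_def)
    ultimately show ?R using F by (auto simp: graph_compl_def complete_on_def)
  next
    assume R: ?R
    then obtain S where "S \<subseteq> edges (complete_on N)" "verts (graph_compl G) = verts H"
      "edges (graph_compl G) = edges (graph_compl H) \<union> S"
      by blast
    then have S: "S \<subseteq> all_edges N" and V: "verts G = verts H"
      and E: "all_edges (verts G) - edges G = all_edges (verts G) - edges H \<union> S"
      by (simp_all add: graph_compl_def complete_on_def)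
    have H: "edges H \<subseteq> all_edges (verts G)" using R V by (auto simp: simple_graph_def)
    have "edges H = edges G \<union> (edges H - edges G)" using E G(2) by blast
    moreover have "edges H - edges G \<subseteq> all_edges N" using E H S by blast
    ultimately show ?L
      using V by (intro bexI[of _ "edges H - edges G"]) (auto intro: sgraph.expand)
  qed
qed

theorem theorem5p4:
  fixes G :: "'a sgraph" and N :: "'a set"
  assumes "probe_graph G N"
  shows "probe_mr G N \<le> 2 \<longleftrightarrow>
    (\<exists>(H :: 'a sgraph) S.
       simple_graph H \<and>
       (\<exists>(k :: nat) (s1 :: nat) (s2 :: nat) (p :: nat \<Rightarrow> nat) (q :: nat \<Rightarrow> nat) (r :: nat).
          (\<forall>i<k. p i + q i > 0) \<and>
          graph_iso (graph_compl H)
            (graph_join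
               (disjoint_union
                  (disjoint_union (complete_graph s1) (complete_graph s2))
                  (disjoint_Union {..<k} (\<lambda>i. complete_bipartite (p i) (q i))))
               (complete_graph r))) \<and>
       S \<subseteq> edges (complete_on N) \<and>
       verts (graph_compl G) = verts H \<and>
       edges (graph_compl G) = edges (graph_compl H) \<union> S)"
proof -
  define model where "model H \<longleftrightarrow> (\<exists>k s1 s2 p q r. (\<forall>i<k. p i + q i > 0)
    \<and> graph_iso (graph_compl H) (model_graph s1 s2 k p q r))" for H :: "'a sgraph"
  have model: "(\<exists>A\<in>sym_matrices H. mat_rank (verts H) A \<le> 2) \<longleftrightarrow> model H"
    if "simple_graph H" for H :: "'a sgraph"
    using min_rank_two_iff_complement[OF that] by (simp only: model_def)
  have "probe_mr G N \<le> 2 \<longleftrightarrow>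
      (\<exists>H. (\<exists>F \<in> Pow (all_edges N). H = Graph (verts G) (edges G \<union> F))
         \<and> (\<exists>A\<in>sym_matrices H. mat_rank (verts H) A \<le> 2))" (is "_ \<longleftrightarrow> (\<exists>H. ?add H \<and> ?low H)")
  proof -
    have "(\<exists>H. ?add H \<and> ?low H)
        \<longleftrightarrow> (\<exists>F\<in>Pow (all_edges N). ?low (Graph (verts G) (edges G \<union> F)))"
      by blast
    then show ?thesis by (simp add: probe_mr_le_iff probe_matrices_def)
  qed
  also have "\<dots> \<longleftrightarrow> (\<exists>H S. simple_graph H \<and> model H \<and>
       S \<subseteq> edges (complete_on N) \<and>
       verts (graph_compl G) = verts H \<and>
       edges (graph_compl G) = edges (graph_compl H) \<union> S)"
  proof (intro ex_cong1)
    fix H :: "'a sgraph"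
    show "?add H \<and> ?low H \<longleftrightarrow> (\<exists>S. simple_graph H \<and> model H \<and> S \<subseteq> edges (complete_on N) \<and>
       verts (graph_compl G) = verts H \<and> edges (graph_compl G) = edges (graph_compl H) \<union> S)"
      unfolding graph_compl_add_nonprobe_edges[OF assms]
      using model[of H] by (cases "simple_graph H"; cases "model H") simp_all
  qed
  finally show ?thesis unfolding model_def model_graph_def .
qed

end
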